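(* There exist $2\times 2$ matrices $A_1,A_2,A_3,A_4$ in Jordan form over $\mathbb{R}$ such that $(A_1,A_2,A_3,A_4)$ is hypercyclic on $\mathbb{R}^2$; in particular, its set of hypercyclic vectors is $$HC((A_1,A_2,A_3,A_4))=\left\{\begin{pmatrix} x_1 \\ x_2 \end{pmatrix}\in\mathbb{R}^2 : x_2\neq 0\right\}.$$
   Context: A $2\times 2$ matrix is said to be in Jordan form over a field $\mathbb{F}$ ($\mathbb{R}$ or $\mathbb{C}$) if it is of the form $\begin{pmatrix} a & 1 \\ 0 & a \end{pmatrix}$ with $a\in\mathbb{F}$ (any two such matrices commute). A tuple $(T_1,\ldots,T_m)$ of pairwise commuting continuous linear operators on a space $X$ is hypercyclic if there is $x\in X$ such that $\{T_1^{k_1}\cdots T_m^{k_m}x : k_1,\ldots,k_m\geq 0 \text{ integers}\}$ is dense in $X$; such an $x$ is called a hypercyclic vector, and $HC((T_1,\ldots,T_m))$ denotes the set of all hypercyclic vectors. *)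

theory Defs
  imports "HOL-Analysis.Analysis"
begin

definition jordan_form :: "'a::field^2^2 \<Rightarrow> bool" where
  "jordan_form A \<longleftrightarrow> (\<exists>a. A = vector [vector [a, 1], vector [0, a]])"

text \<open>
  A tuple \<open>(T\<^sub>1, \<dots>, T\<^sub>m)\<close> of operators is the list \<open>[T\<^sub>1, \<dots>, T\<^sub>m]\<close>. On a normed space,
  \<^const>\<open>bounded_linear\<close> is the same as linear and continuous.
\<close>

definition commuting_tuple :: "('a::real_normed_vector \<Rightarrow> 'a) list \<Rightarrow> bool" where
  "commuting_tuple Ts \<longleftrightarrow>
     (\<forall>T\<in>set Ts. bounded_linear T) \<and> (\<forall>S\<in>set Ts. \<forall>T\<in>set Ts. S \<circ> T = T \<circ> S)"

text \<open>The operator \<open>T\<^sub>1\<^bsup>k\<^sub>1\<^esup> \<cdots> T\<^sub>m\<^bsup>k\<^sub>m\<^esup>\<close>, for lists of equal length.\<close>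

fun tuple_power :: "('a \<Rightarrow> 'a) list \<Rightarrow> nat list \<Rightarrow> 'a \<Rightarrow> 'a" where
  "tuple_power (T # Ts) (k # ks) = (T ^^ k) \<circ> tuple_power Ts ks"
| "tuple_power _ _ = id"

definition tuple_orbit :: "('a \<Rightarrow> 'a) list \<Rightarrow> 'a \<Rightarrow> 'a set" where
  "tuple_orbit Ts x = {tuple_power Ts ks x | ks. length ks = length Ts}"

definition HC :: "('a::real_normed_vector \<Rightarrow> 'a) list \<Rightarrow> 'a set" where
  "HC Ts = {x. closure (tuple_orbit Ts x) = UNIV}"

definition hypercyclic :: "('a::real_normed_vector \<Rightarrow> 'a) list \<Rightarrow> bool" where
  "hypercyclic Ts \<longleftrightarrow> commuting_tuple Ts \<and> (\<exists>x. x \<in> HC Ts)"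

end

theory Submission
  imports Defs
begin

text \<open>
  Write \<open>J a\<close> for the Jordan block with eigenvalue \<open>a\<close>. A product of powers \<open>J a\<^sub>i ^ k\<^sub>i\<close> sends \<open>(x\<^sub>1, x\<^sub>2)\<close> to
  \<open>(P (x\<^sub>1 + S x\<^sub>2), P x\<^sub>2)\<close>, where \<open>P\<close> is the product of the \<open>a\<^sub>i ^ k\<^sub>i\<close> and \<open>S\<close> is the sum of the
  \<open>k\<^sub>i / a\<^sub>i\<close>, so for \<open>x\<^sub>2 \<noteq> 0\<close> it suffices that the triples (sign of \<open>P\<close>, \<open>ln \<bar>P\<bar>\<close>, \<open>S\<close>) are dense.
  For the eigenvalues \<open>a, -a, b, -b\<close> with \<open>0 < b < 1 < a\<close>, \<open>ln \<bar>P\<bar>\<close> depends on the sums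
  \<open>k\<^sub>1 + k\<^sub>2, k\<^sub>3 + k\<^sub>4\<close> only and \<open>S\<close> on the differences \<open>k\<^sub>1 - k\<^sub>2, k\<^sub>3 - k\<^sub>4\<close> only. So two applications of
  Kronecker's theorem in dimension one suffice, given that \<open>ln a / ln b\<close> and \<open>a / b\<close> are irrational,
  as they are for \<open>a = sqrt 2\<close>, \<open>b = 1 / 3\<close>.
\<close>

section \<open>Approximation by integer combinations\<close>

text \<open>Division by \<beta> turns this into density of the fractional parts of the multiples of
  an irrational number.\<close>

lemma int_combination_approx:
  fixes \<alpha> \<beta> u \<epsilon> :: real
  assumes irr: "\<alpha> / \<beta> \<notin> \<rat>" and "\<epsilon> > 0"
  obtains m n :: int where "m > 0" "\<bar>m * \<alpha> + n * \<beta> - u\<bar> < \<epsilon>"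
proof -
  have "\<beta> \<noteq> 0" using irr by auto
  then have "\<epsilon> / \<bar>\<beta>\<bar> > 0" using \<open>\<epsilon> > 0\<close> by simp
  then obtain h k where k: "k > 0" "\<bar>of_int k * (\<alpha> / \<beta>) - of_int h - u / \<beta>\<bar> < \<epsilon> / \<bar>\<beta>\<bar>"
    using sequence_of_fractional_parts_is_dense [OF irr, where \<alpha> = "u / \<beta>"] by metis
  have "of_int k * \<alpha> + of_int (- h) * \<beta> - u = \<beta> * (of_int k * (\<alpha> / \<beta>) - of_int h - u / \<beta>)"
    using \<open>\<beta> \<noteq> 0\<close> by (simp add: field_simps)
  then have "\<bar>of_int k * \<alpha> + of_int (- h) * \<beta> - u\<bar>
      = \<bar>\<beta>\<bar> * \<bar>of_int k * (\<alpha> / \<beta>) - of_int h - u / \<beta>\<bar>"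
    by (simp only: abs_mult)
  also have "\<dots> < \<epsilon>"
    using k(2) \<open>\<beta> \<noteq> 0\<close> by (simp add: pos_less_divide_eq mult.commute)
  finally show thesis using that k(1) by blast
qed

text \<open>Replacing \<alpha> by \<open>K * \<alpha>\<close> with \<open>K\<close> large makes the
  first coefficient, a positive multiple of \<open>K\<close>, large. As \<beta> is negative, the
  second must then be large too.\<close>

lemma nat_combination_approx:
  fixes \<alpha> \<beta> u \<epsilon> :: real and N :: nat
  assumes irr: "\<alpha> / \<beta> \<notin> \<rat>" and "\<alpha> > 0" "\<beta> < 0" "\<epsilon> > 0"
  obtains m n :: nat where "m \<ge> N" "n \<ge> N" "\<bar>m * \<alpha> + n * \<beta> - u\<bar> < \<epsilon>"
proof -
  \<comment> \<open>If \<open>m \<ge> K0\<close> and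
    \<open>m * \<alpha> + n * \<beta> < u + \<epsilon>\<close>, then
    \<open>n * \<beta> < N * \<beta>\<close>, hence \<open>n > N\<close>.\<close>
  obtain K0 :: nat where "(u + \<epsilon> - N * \<beta>) / \<alpha> < K0"
    using reals_Archimedean2 by blast
  then have K0: "u + \<epsilon> - N * \<beta> < K0 * \<alpha>"
    using \<open>\<alpha> > 0\<close> by (simp add: pos_divide_less_eq)
  define K where "K = max 1 (max K0 N)"
  have "K > 0" by (simp add: K_def)
  have "(K * \<alpha>) / \<beta> \<notin> \<rat>"
  proof
    assume "(K * \<alpha>) / \<beta> \<in> \<rat>"
    then have "(K * \<alpha>) / \<beta> / K \<in> \<rat>" by (rule Rats_divide) simp
    with irr \<open>K > 0\<close> show False by simp
  qed
  then obtain k n :: int where k: "k > 0" and kn: "\<bar>k * (K * \<alpha>) + n * \<beta> - u\<bar> < \<epsilon>"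
    using int_combination_approx \<open>\<epsilon> > 0\<close> by metis
  have "1 * real K \<le> k * real K"
    using k by (intro mult_right_mono) auto
  then have "K * \<alpha> \<le> k * real K * \<alpha>"
    using \<open>\<alpha> > 0\<close> by (intro mult_right_mono) auto
  moreover have "K0 * \<alpha> \<le> K * \<alpha>"
    using \<open>\<alpha> > 0\<close> by (intro mult_right_mono) (auto simp: K_def)
  ultimately have "n * \<beta> < N * \<beta>"
    using K0 kn by (simp add: mult.assoc)
  then have "n \<ge> int N" using \<open>\<beta> < 0\<close> by simp
  have "nat k * K \<ge> 1 * K" using k by (intro mult_right_mono) auto
  show thesis
  proof (rule that)
    show "nat k * K \<ge> N" using \<open>nat k * K \<ge> 1 * K\<close> by (simp add: K_def)
    show "nat n \<ge> N" using \<open>n \<ge> int N\<close> by simp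
    show "\<bar>(nat k * K) * \<alpha> + nat n * \<beta> - u\<bar> < \<epsilon>"
      using kn k \<open>n \<ge> int N\<close> by (simp add: mult.assoc)
  qed
qed

text \<open>
  The exponents are \<open>k = 2 (m + n)\<close>, \<open>l = 2 (m - n) + e\<close> for each of the pairs \<open>(k\<^sub>1, k\<^sub>2)\<close>, \<open>(k\<^sub>3, k\<^sub>4)\<close>,
  where \<open>e\<close> adjusts the parity. The \<open>n\<close> are chosen first, then the \<open>m\<close> large enough to keep all
  exponents nonnegative.
\<close>

lemma exponents_approx:
  fixes \<alpha> \<beta> \<gamma> \<delta> t s \<epsilon> :: real
  assumes "\<alpha> / \<beta> \<notin> \<rat>" "\<alpha> > 0" "\<beta> < 0" "\<gamma> / \<delta> \<notin> \<rat>" "\<epsilon> > 0"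
  obtains k\<^sub>1 k\<^sub>2 k\<^sub>3 k\<^sub>4 :: nat where "even (k\<^sub>2 + k\<^sub>4) \<longleftrightarrow> ev"
    "\<bar>(real k\<^sub>1 + k\<^sub>2) * \<alpha> + (real k\<^sub>3 + k\<^sub>4) * \<beta> - t\<bar> < \<epsilon>"
    "\<bar>(real k\<^sub>1 - k\<^sub>2) * \<gamma> + (real k\<^sub>3 - k\<^sub>4) * \<delta> - s\<bar> < \<epsilon>"
proof -
  define e :: nat where "e = of_bool (\<not> ev)"
  have "\<epsilon> / 4 > 0" using \<open>\<epsilon> > 0\<close> by simp
  \<comment> \<open>The exponents below satisfy
    \<open>k\<^sub>1 - k\<^sub>2 = 4 * n\<^sub>1 - e\<close> and
    \<open>k\<^sub>1 + k\<^sub>2 = 4 * m\<^sub>1 + e\<close>, while the second pair has no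
    \<open>e\<close>. This explains the shifted targets and the factor 4.\<close>
  obtain n\<^sub>1 n\<^sub>2 :: int where n: "\<bar>n\<^sub>1 * \<gamma> + n\<^sub>2 * \<delta> - (s + e * \<gamma>) / 4\<bar> < \<epsilon> / 4"
    using int_combination_approx [OF \<open>\<gamma> / \<delta> \<notin> \<rat>\<close> \<open>\<epsilon> / 4 > 0\<close>] by metis
  obtain m\<^sub>1 m\<^sub>2 :: nat where m_ge: "m\<^sub>1 \<ge> nat (\<bar>n\<^sub>1\<bar> + \<bar>n\<^sub>2\<bar>)" "m\<^sub>2 \<ge> nat (\<bar>n\<^sub>1\<bar> + \<bar>n\<^sub>2\<bar>)"
    and m: "\<bar>m\<^sub>1 * \<alpha> + m\<^sub>2 * \<beta> - (t - e * \<alpha>) / 4\<bar> < \<epsilon> / 4"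
    using nat_combination_approx [OF assms(1-3) \<open>\<epsilon> / 4 > 0\<close>] by metis
  \<comment> \<open>The index \<open>True\<close> stands for the first pair of exponents,
    \<open>False\<close> for the second. By \<open>m_ge\<close>, \<open>nat\<close> truncates
    nothing.\<close>
  define p q where "p i = nat (int (if i then m\<^sub>1 else m\<^sub>2) + (if i then n\<^sub>1 else n\<^sub>2))"
    and "q i = nat (int (if i then m\<^sub>1 else m\<^sub>2) - (if i then n\<^sub>1 else n\<^sub>2))" for i
  have pq: "real (p True) = m\<^sub>1 + n\<^sub>1" "real (q True) = m\<^sub>1 - n\<^sub>1"
    "real (p False) = m\<^sub>2 + n\<^sub>2" "real (q False) = m\<^sub>2 - n\<^sub>2"
    using m_ge by (auto simp: p_def q_def)
  show thesis
  proof (rule that)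
    show "even (2 * q True + e + 2 * q False) \<longleftrightarrow> ev"
      by (simp add: e_def)
    show "\<bar>(real (2 * p True) + real (2 * q True + e)) * \<alpha>
        + (real (2 * p False) + real (2 * q False)) * \<beta> - t\<bar> < \<epsilon>"
      using m unfolding abs_less_iff by (simp add: pq field_simps)
    show "\<bar>(real (2 * p True) - real (2 * q True + e)) * \<gamma>
        + (real (2 * p False) - real (2 * q False)) * \<delta> - s\<bar> < \<epsilon>"
      using n unfolding abs_less_iff by (simp add: pq field_simps)
  qed
qed

section \<open>Jordan blocks and their powers\<close>

definition jordan_block :: "'a::field \<Rightarrow> 'a^2^2" where
  "jordan_block a = vector [vector [a, 1], vector [0, a]]"

lemma jordan_form_jordan_block: "jordan_form (jordan_block a)"
  by (auto simp: jordan_form_def jordan_block_def)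

lemma jordan_block_mult_vec:
  "(jordan_block a *v x) $ 1 = a * x $ 1 + x $ 2" "(jordan_block a *v x) $ 2 = a * x $ 2"
  by (simp_all add: jordan_block_def matrix_vector_mult_def sum_2)

lemma jordan_block_commute:
  "jordan_block a *v (jordan_block b *v x) = jordan_block b *v (jordan_block a *v x)"
  by (simp add: vec_eq_iff forall_2 jordan_block_mult_vec algebra_simps)

text \<open>With \<open>a ^ k\<close> factored out, the terms \<open>k / a\<close> simply add up
  when powers of different blocks are composed.\<close>

lemma jordan_block_funpow:
  fixes a :: "'a::field"
  assumes "a \<noteq> 0"
  shows "(((*v) (jordan_block a)) ^^ k) x $ 1 = a ^ k * (x $ 1 + of_nat k / a * x $ 2)"
    and "(((*v) (jordan_block a)) ^^ k) x $ 2 = a ^ k * x $ 2"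
  by (induction k) (use assms in \<open>simp_all add: jordan_block_mult_vec field_simps\<close>)

lemma commuting_tuple_jordan_blocks:
  fixes as :: "real list"
  shows "commuting_tuple (map (\<lambda>a. (*v) (jordan_block a)) as)"
  by (auto simp: commuting_tuple_def fun_eq_iff jordan_block_commute intro: matrix_vector_mul_bounded_linear)

section \<open>Orbits under the four blocks\<close>

context
  fixes a b :: real
  assumes a: "a > 1" and b: "0 < b" "b < 1"
    and irr_ln: "ln a / ln b \<notin> \<rat>" and irr: "(1 / a) / (1 / b) \<notin> \<rat>"
begin

private abbreviation "blocks \<equiv> map (\<lambda>c. (*v) (jordan_block c)) [a, - a, b, - b]"

text \<open>The product \<open>P\<close> is encoded as \<open>\<sigma> * exp t\<close>, so that for
  a fixed sign \<sigma> the map is continuous on the whole plane of pairs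
  \<open>(t, s)\<close>.\<close>

private definition orbit_map :: "real \<Rightarrow> real^2 \<Rightarrow> real \<times> real \<Rightarrow> real^2" where
  "orbit_map \<sigma> x = (\<lambda>(t, s). vector [\<sigma> * exp t * (x $ 1 + s * x $ 2), \<sigma> * exp t * x $ 2])"

lemma tuple_power_blocks:
  "tuple_power blocks [k\<^sub>1, k\<^sub>2, k\<^sub>3, k\<^sub>4] x = orbit_map ((- 1) ^ (k\<^sub>2 + k\<^sub>4)) x
     ((real k\<^sub>1 + k\<^sub>2) * ln a + (real k\<^sub>3 + k\<^sub>4) * ln b, (real k\<^sub>1 - k\<^sub>2) * (1 / a) + (real k\<^sub>3 - k\<^sub>4) * (1 / b))"
proof -
  have P: "exp ((real k\<^sub>1 + k\<^sub>2) * ln a + (real k\<^sub>3 + k\<^sub>4) * ln b) = a ^ k\<^sub>1 * a ^ k\<^sub>2 * b ^ k\<^sub>3 * b ^ k\<^sub>4"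
    using a b by (simp add: exp_add distrib_right exp_of_nat_mult)
  have neg: "(- c) ^ k = (- 1) ^ k * c ^ k" for c :: real and k
    using power_mult_distrib [of "- 1" c k] by simp
  show ?thesis
    unfolding orbit_map_def prod.case P
    using a b
    by (simp add: vec_eq_iff forall_2 jordan_block_funpow power_add
        neg [of a] neg [of b] algebra_simps)
qed

text \<open>For the right sign \<sigma>, the parameters that \<open>orbit_map\<close> sends into the
  orbit are dense in the plane. By continuity the closure of the orbit contains every
  \<open>y\<close> with \<open>y $ 2 \<noteq> 0\<close>, and these \<open>y\<close> are
  dense.\<close>

lemma tuple_orbit_blocks_dense:
  assumes "x $ 2 \<noteq> 0"
  shows "closure (tuple_orbit blocks x) = UNIV"
proof -
  have "y \<in> closure (tuple_orbit blocks x)" if y: "y $ 2 \<noteq> 0" for y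
  proof -
    define \<sigma> :: real where "\<sigma> = sgn (y $ 2 / x $ 2)"
    define D where "D = {w. orbit_map \<sigma> x w \<in> tuple_orbit blocks x}"
    have "(t, s) \<in> closure D" for t s
      unfolding closure_approachable
    proof (intro allI impI)
      fix \<epsilon> :: real assume "\<epsilon> > 0"
      then have "\<epsilon> / 2 > 0" by simp
      obtain k\<^sub>1 k\<^sub>2 k\<^sub>3 k\<^sub>4 :: nat where ev: "even (k\<^sub>2 + k\<^sub>4) \<longleftrightarrow> \<sigma> = 1"
        and t: "\<bar>(real k\<^sub>1 + k\<^sub>2) * ln a + (real k\<^sub>3 + k\<^sub>4) * ln b - t\<bar> < \<epsilon> / 2" (is "\<bar>?t - t\<bar> < _")
        and s: "\<bar>(real k\<^sub>1 - k\<^sub>2) * (1 / a) + (real k\<^sub>3 - k\<^sub>4) * (1 / b) - s\<bar> < \<epsilon> / 2" (is "\<bar>?s - s\<bar> < _")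
        by (rule exponents_approx [OF irr_ln _ _ irr \<open>\<epsilon> / 2 > 0\<close>, of "\<sigma> = 1" t s]) (use a b in auto)
      have "\<sigma> = 1 \<or> \<sigma> = - 1"
        using assms y by (auto simp: \<sigma>_def sgn_if)
      with ev have "(- 1) ^ (k\<^sub>2 + k\<^sub>4) = \<sigma>"
        by (metis neg_one_even_power neg_one_odd_power)
      then have "orbit_map \<sigma> x (?t, ?s) = tuple_power blocks [k\<^sub>1, k\<^sub>2, k\<^sub>3, k\<^sub>4] x"
        using tuple_power_blocks by metis
      then have "(?t, ?s) \<in> D"
        by (auto simp: D_def tuple_orbit_def intro!: exI [of _ "[k\<^sub>1, k\<^sub>2, k\<^sub>3, k\<^sub>4]"])
      moreover have "dist (?t, ?s) (t, s) < \<epsilon>"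
        using t s norm_Pair_le [of "?t - t" "?s - s"] by (simp add: dist_norm)
      ultimately show "\<exists>w\<in>D. dist w (t, s) < \<epsilon>" by blast
    qed
    then have "closure D = UNIV" by auto
    have "continuous_on UNIV (orbit_map \<sigma> x)"
    proof -
      have "orbit_map \<sigma> x = (\<lambda>w. \<chi> i. if i = 1 then \<sigma> * exp (fst w) * (x $ 1 + snd w * x $ 2)
          else \<sigma> * exp (fst w) * x $ 2)"
        by (auto simp: fun_eq_iff vec_eq_iff forall_2 orbit_map_def)
      moreover have "continuous_on UNIV \<dots>"
      proof (rule continuous_on_vec_lambda)
        show "continuous_on UNIV (\<lambda>w. if i = 1 then \<sigma> * exp (fst w) * (x $ 1 + snd w * x $ 2)
            else \<sigma> * exp (fst w) * x $ 2)" for i :: 2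
          by (cases "i = 1") (auto intro!: continuous_intros)
      qed
      ultimately show ?thesis by simp
    qed
    then have "orbit_map \<sigma> x ` closure D \<subseteq> closure (tuple_orbit blocks x)"
      using \<open>closure D = UNIV\<close> closure_subset [of "tuple_orbit blocks x"]
      by (intro image_closure_subset) (auto simp: D_def)
    \<comment> \<open>The second coordinate forces \<open>P = y $ 2 / x $ 2\<close>; the first is
      then solved for \<open>s\<close>.\<close>
    moreover have "y = orbit_map \<sigma> x (ln \<bar>y $ 2 / x $ 2\<bar>, (y $ 1 * x $ 2 / y $ 2 - x $ 1) / x $ 2)"
    proof -
      have "\<sigma> * exp (ln \<bar>y $ 2 / x $ 2\<bar>) = y $ 2 / x $ 2"
        using assms y sgn_mult_abs [of "y $ 2 / x $ 2"] by (simp add: \<sigma>_def del: sgn_divide)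
      then show ?thesis
        using assms y by (simp add: vec_eq_iff forall_2 orbit_map_def)
    qed
    ultimately show ?thesis
      using \<open>closure D = UNIV\<close> by blast
  qed
  then have "closure {y::real^2. y $ 2 \<noteq> 0} \<subseteq> closure (tuple_orbit blocks x)"
    by (intro closure_minimal) auto
  moreover have "closure {y::real^2. y $ 2 \<noteq> 0} = UNIV"
  proof -
    have "{y::real^2. y $ 2 \<noteq> 0} = - {y. axis 2 1 \<bullet> y = 0}"
      by (auto simp: inner_axis')
    then show ?thesis
      by (simp add: closure_complement interior_hyperplane axis_eq_0_iff)
  qed
  ultimately show ?thesis by auto
qed

text \<open>Conversely, the blocks only rescale the second coordinate, so an orbit starting on the
  closed line \<open>x $ 2 = 0\<close> never leaves it.\<close>

lemma HC_blocks: "HC blocks = {x. x $ 2 \<noteq> 0}"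
proof (intro equalityI subsetI)
  fix x :: "real^2" assume "x \<in> {x. x $ 2 \<noteq> 0}"
  then show "x \<in> HC blocks"
    using tuple_orbit_blocks_dense by (simp add: HC_def)
next
  fix x :: "real^2" assume x: "x \<in> HC blocks"
  show "x \<in> {x. x $ 2 \<noteq> 0}"
  proof (rule ccontr)
    assume "x \<notin> {x. x $ 2 \<noteq> 0}"
    then have "tuple_orbit blocks x \<subseteq> {y. y $ 2 = 0}"
      using a b by (auto simp: tuple_orbit_def length_Suc_conv jordan_block_funpow)
    moreover have "closed {y::real^2. y $ 2 = 0}"
      by (intro closed_Collect_eq continuous_intros)
    ultimately have "closure (tuple_orbit blocks x) \<subseteq> {y. y $ 2 = 0}"
      by (rule closure_minimal)
    moreover have "axis 2 1 \<in> closure (tuple_orbit blocks x)"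
      using x unfolding HC_def by blast
    ultimately have "(axis 2 1 :: real^2) $ 2 = 0" by blast
    then show False by simp
  qed
qed

lemma hypercyclic_blocks: "hypercyclic blocks"
  unfolding hypercyclic_def HC_blocks
  by (intro conjI commuting_tuple_jordan_blocks exI [of _ "axis 2 1"]) simp

end

section \<open>Irrationality and the choice of eigenvalues\<close>

lemma sqrt_2_irrational: "sqrt 2 \<notin> \<rat>"
proof
  assume "sqrt 2 \<in> \<rat>"
  then obtain m n :: nat where "n \<noteq> 0" and mn: "\<bar>sqrt 2\<bar> = m / n" and "coprime m n"
    by (rule Rats_abs_nat_div_natE)
  then have "m = sqrt 2 * n" by (simp add: field_simps)
  then have "(real m)\<^sup>2 = 2 * (real n)\<^sup>2" by (simp add: power_mult_distrib)
  then have eq: "m\<^sup>2 = 2 * n\<^sup>2"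
    by (metis of_nat_eq_iff of_nat_mult of_nat_numeral of_nat_power)
  then have "even m" by (metis dvd_triv_left even_power)
  then obtain k where "m = 2 * k" by blast
  with eq have "n\<^sup>2 = 2 * k\<^sup>2" by (simp add: power_mult_distrib)
  then have "even n" by (metis dvd_triv_left even_power)
  with \<open>even m\<close> \<open>coprime m n\<close> show False
    by (metis coprime_common_divisor odd_one)
qed

text \<open>A rational value would give \<open>2 ^ n = 3 ^ m\<close> with
  \<open>n \<noteq> 0\<close>, against parity.\<close>

lemma ln_2_over_ln_3_irrational: "ln 2 / ln (3::real) \<notin> \<rat>"
proof
  assume "ln 2 / ln (3::real) \<in> \<rat>"
  then obtain m n :: nat where "n \<noteq> 0" and "\<bar>ln 2 / ln (3::real)\<bar> = m / n"
    by (rule Rats_abs_nat_div_natE)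
  then have "n * ln (2::real) = m * ln 3"
    by (simp add: field_simps)
  then have "ln ((2::real) ^ n) = ln (3 ^ m)"
    by (simp add: ln_realpow)
  then have "real (2 ^ n) = real (3 ^ m)"
    by simp
  then have "(2::nat) ^ n = 3 ^ m"
    using of_nat_eq_iff by blast
  then have "even ((3::nat) ^ m)"
    using \<open>n \<noteq> 0\<close> by (metis dvd_power even_numeral gr0I)
  then show False by simp
qed

theorem theorem1p2:
  shows "\<exists>A\<^sub>1 A\<^sub>2 A\<^sub>3 A\<^sub>4 :: real^2^2.
    jordan_form A\<^sub>1 \<and> jordan_form A\<^sub>2 \<and> jordan_form A\<^sub>3 \<and> jordan_form A\<^sub>4 \<and>
    hypercyclic [(*v) A\<^sub>1, (*v) A\<^sub>2, (*v) A\<^sub>3, (*v) A\<^sub>4] \<and>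
    HC [(*v) A\<^sub>1, (*v) A\<^sub>2, (*v) A\<^sub>3, (*v) A\<^sub>4] = {x. x $ 2 \<noteq> 0}"
proof -
  \<comment> \<open>Here \<open>ln a / ln b = - ln 2 / (2 * ln 3)\<close> and
    \<open>b / a = 1 / (3 * sqrt 2)\<close>.\<close>
  define a b :: real where "a = sqrt 2" and "b = 1 / 3"
  have ab: "a > 1" "0 < b" "b < 1" by (auto simp: a_def b_def)
  have ln_irr: "ln a / ln b \<notin> \<rat>"
  proof
    assume "ln a / ln b \<in> \<rat>"
    then have "- 2 * (ln a / ln b) \<in> \<rat>" by (rule Rats_mult [rotated]) simp
    also have "- 2 * (ln a / ln b) = ln 2 / ln 3"
      by (simp add: a_def b_def ln_sqrt ln_div)
    finally show False using ln_2_over_ln_3_irrational by simp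
  qed
  have irr: "(1 / a) / (1 / b) \<notin> \<rat>"
  proof
    assume "(1 / a) / (1 / b) \<in> \<rat>"
    then have "(1 / 3) / ((1 / a) / (1 / b)) \<in> \<rat>" by (rule Rats_divide [rotated]) simp
    also have "(1 / 3) / ((1 / a) / (1 / b)) = sqrt 2"
      by (simp add: a_def b_def)
    finally show False using sqrt_2_irrational by simp
  qed
  show ?thesis
    using hypercyclic_blocks [OF ab ln_irr irr] HC_blocks [OF ab ln_irr irr]
    by (auto intro!: exI jordan_form_jordan_block)
qed

end
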